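(* If $f=h+\overline{g}\in\mathcal{F}_0$, then $\|P_f\|\le 5$. The estimate is best possible, i.e. the constant $5$ cannot be replaced by any smaller constant valid for all $f\in\mathcal{F}_0$.
   Context: $\mathbb{D}=\{z\in\mathbb{C}:|z|<1\}$. $\mathcal{H}$ is the class of all complex-valued harmonic mappings $f=h+\overline{g}$ in $\mathbb{D}$ with $h,g$ analytic in $\mathbb{D}$ and $h(0)=h'(0)-1=g(0)=0$, so that $h(z)=z+\sum_{n=2}^\infty a_nz^n$ and $g(z)=\sum_{n=1}^\infty b_nz^n$. $Aut(\mathbb{D})=\{e^{i\theta}\frac{z-a}{1-\overline{a}z}: a\in\mathbb{D},\ \theta\in\mathbb{R}\}$. $\mathcal{F}_0$ is the class of all $f=h+\overline{g}\in\mathcal{H}$ such that $h'\ne 0$ in $\mathbb{D}$, $$\mathrm{Re}\left(1+\frac{zh''(z)}{h'(z)}\right)>0\quad\text{for all } z\in\mathbb{D},$$ and the dilatation $\omega_f=g'/h'$ belongs to $Aut(\mathbb{D})$. The Jacobian of $f$ is $J_f=|h'|^2-|g'|^2$. For a locally univalent sense-preserving harmonic mapping $f=h+\overline{g}$ with dilatation $\omega=g'/h'$, the pre-Schwarzian derivative is $$P_f=(\log J_f)_z=\frac{h''}{h'}-\frac{\overline{\omega}\,\omega'}{1-|\omega|^2},$$ and the pre-Schwarzian norm is $\|P_f\|=\sup_{z\in\mathbb{D}}(1-|z|^2)|P_f(z)|$. *)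

theory Defs
  imports "HOL-Complex_Analysis.Complex_Analysis"
begin

abbreviation unit_disk :: "complex set" where
  "unit_disk \<equiv> ball 0 1"

text \<open>
  A harmonic mapping is represented together with its canonical decomposition
  \<open>f = h + cnj g\<close> on the disk; the normalisation makes \<open>h\<close> and \<open>g\<close> unique there.
  Values outside the disk are irrelevant throughout.
\<close>

definition class_H :: "(complex \<Rightarrow> complex) \<Rightarrow> (complex \<Rightarrow> complex) \<Rightarrow> (complex \<Rightarrow> complex) \<Rightarrow> bool" where
  "class_H f h g \<longleftrightarrow>
     (\<forall>z\<in>unit_disk. f z = h z + cnj (g z)) \<and>
     h holomorphic_on unit_disk \<and> g holomorphic_on unit_disk \<and>
     h 0 = 0 \<and> deriv h 0 - 1 = 0 \<and> g 0 = 0"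

text \<open>Membership in \<open>Aut(\<D>)\<close>, for the restriction of a total function to the disk.\<close>

definition disk_automorphism :: "(complex \<Rightarrow> complex) \<Rightarrow> bool" where
  "disk_automorphism \<phi> \<longleftrightarrow>
     (\<exists>\<theta>::real. \<exists>a\<in>unit_disk. \<forall>z\<in>unit_disk.
        \<phi> z = exp (\<i> * of_real \<theta>) * ((z - a) / (1 - cnj a * z)))"

definition dilatation :: "(complex \<Rightarrow> complex) \<Rightarrow> (complex \<Rightarrow> complex) \<Rightarrow> complex \<Rightarrow> complex" where
  "dilatation h g z = deriv g z / deriv h z"

definition class_F0 :: "(complex \<Rightarrow> complex) \<Rightarrow> (complex \<Rightarrow> complex) \<Rightarrow> (complex \<Rightarrow> complex) \<Rightarrow> bool" where
  "class_F0 f h g \<longleftrightarrow>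
     class_H f h g \<and>
     (\<forall>z\<in>unit_disk. deriv h z \<noteq> 0) \<and>
     (\<forall>z\<in>unit_disk. Re (1 + z * deriv (deriv h) z / deriv h z) > 0) \<and>
     disk_automorphism (dilatation h g)"

definition jacobian :: "(complex \<Rightarrow> complex) \<Rightarrow> (complex \<Rightarrow> complex) \<Rightarrow> complex \<Rightarrow> real" where
  "jacobian h g z = (cmod (deriv h z))\<^sup>2 - (cmod (deriv g z))\<^sup>2"

text \<open>
  The Wirtinger derivative \<open>u\<^sub>z = (u\<^sub>x - \<i> u\<^sub>y) / 2\<close>; the partial derivatives are the
  real Frechet derivative applied to \<open>1\<close> and \<open>\<i>\<close>.
\<close>

definition wirtinger_z :: "(complex \<Rightarrow> complex) \<Rightarrow> complex \<Rightarrow> complex" where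
  "wirtinger_z u z =
     (frechet_derivative u (at z) 1 - \<i> * frechet_derivative u (at z) \<i>) / 2"

definition pre_schwarzian :: "(complex \<Rightarrow> complex) \<Rightarrow> (complex \<Rightarrow> complex) \<Rightarrow> complex \<Rightarrow> complex" where
  "pre_schwarzian h g = wirtinger_z (\<lambda>w. of_real (ln (jacobian h g w)))"

text \<open>The supremum is taken in \<open>ereal\<close>, so that it is meaningful also when it is infinite.\<close>

definition pre_schwarzian_norm :: "(complex \<Rightarrow> complex) \<Rightarrow> (complex \<Rightarrow> complex) \<Rightarrow> ereal" where
  "pre_schwarzian_norm h g =
     (SUP z\<in>unit_disk. ereal ((1 - (cmod z)\<^sup>2) * cmod (pre_schwarzian h g z)))"

text \<open>
  For locally univalent sense-preserving mappings this is the familiar closed formula.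
\<close>

lemma pre_schwarzian_eq:
  assumes hol: "h holomorphic_on unit_disk" "g holomorphic_on unit_disk"
    and z: "z \<in> unit_disk"
    and pos: "jacobian h g z > 0"
  shows "pre_schwarzian h g z =
           deriv (deriv h) z / deriv h z
             - cnj (dilatation h g z) * deriv (dilatation h g) z
                 / of_real (1 - (cmod (dilatation h g z))\<^sup>2)"
proof -
  define H where "H = deriv h z"
  define G where "G = deriv g z"
  define H' where "H' = deriv (deriv h) z"
  define G' where "G' = deriv (deriv g) z"
  define J where "J = jacobian h g z"
  define A where "A = cnj H * H' - cnj G * G'"
  have J: "J = (cmod H)\<^sup>2 - (cmod G)\<^sup>2" by (simp add: J_def jacobian_def H_def G_def)
  have Jpos: "J > 0" using pos by (simp add: J_def)
  have H0: "H \<noteq> 0" using Jpos J by (auto simp: not_less)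
  have holh: "deriv h holomorphic_on unit_disk" and holg: "deriv g holomorphic_on unit_disk"
    using hol by (auto intro: holomorphic_deriv)
  have dh: "(deriv h has_field_derivative H') (at z)"
    and dg: "(deriv g has_field_derivative G') (at z)"
    unfolding H'_def G'_def using holh holg z by (auto intro: holomorphic_derivI)
  have jac: "jacobian h g = (\<lambda>w. deriv h w \<bullet> deriv h w - deriv g w \<bullet> deriv g w)"
    by (auto simp: jacobian_def dot_square_norm)
  have dJ: "(jacobian h g has_derivative (\<lambda>v. 2 * Re (A * v))) (at z)"
    unfolding jac
    by (rule derivative_eq_intros refl dh[unfolded has_field_derivative_def]
          dg[unfolded has_field_derivative_def])+
       (auto simp: A_def H_def G_def inner_complex_def algebra_simps)
  have "((\<lambda>w. of_real (ln (jacobian h g w))) has_derivative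
           (\<lambda>v. complex_of_real (2 * Re (A * v) / J))) (at z)"
    by (rule derivative_eq_intros refl dJ pos)+ (simp add: J_def field_simps)
  then have "frechet_derivative (\<lambda>w. complex_of_real (ln (jacobian h g w))) (at z)
               = (\<lambda>v. complex_of_real (2 * Re (A * v) / J))"
    by (rule frechet_derivative_at[symmetric])
  then have P: "pre_schwarzian h g z = A / of_real J"
    by (simp add: pre_schwarzian_def wirtinger_z_def complex_eq_iff)
  have "(dilatation h g has_field_derivative (G' * H - G * H') / (H * H)) (at z)"
    using DERIV_divide[OF dg dh] H0 by (simp add: dilatation_def[abs_def] H_def G_def)
  then have D: "deriv (dilatation h g) z = (G' * H - G * H') / (H * H)"
    by (rule DERIV_imp_deriv)
  have W: "dilatation h g z = G / H" by (simp add: dilatation_def H_def G_def)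
  have JC: "complex_of_real J = H * cnj H - G * cnj G"
    by (simp only: J of_real_diff complex_norm_square)
  then have nz: "H * cnj H - G * cnj G \<noteq> 0" using Jpos by (metis less_irrefl of_real_eq_0_iff)
  have q: "complex_of_real (1 - (cmod (G / H))\<^sup>2) = (H * cnj H - G * cnj G) / (H * cnj H)"
    using H0 by (simp only: of_real_diff complex_norm_square) (simp add: field_simps)
  have "A / (H * cnj H - G * cnj G) =
          H' / H - cnj (G / H) * ((G' * H - G * H') / (H * H))
            / ((H * cnj H - G * cnj G) / (H * cnj H))"
    using H0 nz unfolding A_def by (simp add: divide_simps) (simp add: algebra_simps)
  then show ?thesis
    unfolding P JC W D q by (simp add: H_def H'_def)
qed

end

theory Submission imports Defs begin

text \<open>
  The closed formula for \<open>P\<^sub>f\<close> splits it into the pre-Schwarzian \<open>h''/h'\<close> of the analytic part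
  and a term governed by the dilatation \<open>\<omega>\<close>, and the two are estimated independently.

  The first contributes at most 4. If \<open>h\<close> is convex, then \<open>P = z h''/h'\<close> takes values in the
  half-plane \<open>Re w > -1\<close>, which \<open>w \<mapsto> w / (2 + w)\<close> maps into the unit disk fixing the origin.
  The Schwarz lemma applied to \<open>P / (2 + P)\<close> yields \<open>\<bar>h''/h'\<bar> \<le> 2 / (1 - \<bar>z\<bar>)\<close>
  (\<open>convex_pre_schwarzian_bound\<close>), and multiplication by \<open>1 - \<bar>z\<bar>\<^sup>2\<close> leaves
  \<open>2 (1 + \<bar>z\<bar>) < 4\<close>. The second contributes less than 1: an automorphism of the disk is a
  hyperbolic isometry, that is \<open>(1 - \<bar>z\<bar>\<^sup>2) \<bar>\<omega>'\<bar> = 1 - \<bar>\<omega>\<bar>\<^sup>2\<close>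
  (\<open>disk_automorphism_isometry\<close>), so this term is exactly \<open>\<bar>\<omega>\<bar>\<close>.

  Sharpness comes from making both estimates nearly tight at one point \<open>r\<close> close to 1 with the
  two terms having the same sign. The half-plane map \<open>h z = z / (1 - z)\<close> has \<open>h''/h' = 2 / (1 - z)\<close>,
  so it attains \<open>2 (1 + r)\<close> at \<open>r\<close>. The automorphism \<open>\<omega> z = (z - a) / (1 - a z)\<close> with
  \<open>a = 2 r / (1 + r\<^sup>2)\<close> takes the value \<open>-r\<close> at \<open>r\<close> and has positive derivative there, so the
  second term adds \<open>r\<close>. The norm is thus at least \<open>2 + 3 r\<close>, which tends to 5. The zero \<open>a\<close> of
  the dilatation has to move with \<open>r\<close>: for a fixed \<open>a\<close>, \<open>\<omega>\<close> tends to \<open>1\<close> at \<open>1\<close>, so that the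
  second term is eventually subtracted from the first.
\<close>

section \<open>The analytic part\<close>

lemma half_plane_to_disk:
  fixes w :: complex
  assumes "Re w > -1"
  shows "cmod (w / (2 + w)) < 1" and "2 + w \<noteq> 0"
proof -
  show nz: "2 + w \<noteq> 0"
    using assms by (auto simp: complex_eq_iff)
  have "(cmod w)\<^sup>2 < (cmod (2 + w))\<^sup>2"
    using assms unfolding cmod_power2 by (simp add: power2_eq_square algebra_simps)
  then have "cmod w < cmod (2 + w)"
    by (rule power2_less_imp_less) simp
  then show "cmod (w / (2 + w)) < 1"
    using nz by (simp add: norm_divide)
qed

text \<open>
  Here \<open>q\<close> stands for \<open>h''/h'\<close>. The origin needs separate treatment because there the Schwarz
  bound on \<open>z q z\<close> carries no information about \<open>q\<close>; the derivative part of the Schwarz lemma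
  supplies it.
\<close>

lemma convex_pre_schwarzian_bound:
  fixes q :: "complex \<Rightarrow> complex"
  assumes hol: "q holomorphic_on ball 0 1"
    and re: "\<And>z. z \<in> ball 0 1 \<Longrightarrow> Re (1 + z * q z) > 0"
    and z: "z \<in> ball 0 1"
  shows "cmod (q z) \<le> 2 / (1 - cmod z)"
proof -
  define \<phi> where "\<phi> = (\<lambda>w. w * q w / (2 + w * q w))"
  have hp: "Re (w * q w) > -1" if "w \<in> ball 0 1" for w
    using re[OF that] by simp
  have nz: "2 + w * q w \<noteq> 0" if "w \<in> ball 0 1" for w
    using half_plane_to_disk(2)[OF hp[OF that]] .
  have hol\<phi>: "\<phi> holomorphic_on ball 0 1"
    unfolding \<phi>_def using nz by (intro holomorphic_intros hol) auto
  have \<phi>0: "\<phi> 0 = 0"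
    by (simp add: \<phi>_def)
  have \<phi>1: "cmod (\<phi> w) < 1" if "cmod w < 1" for w
    unfolding \<phi>_def by (intro half_plane_to_disk(1) hp) (use that in simp)
  have z1: "cmod z < 1"
    using z by simp
  show ?thesis
  proof (cases "z = 0")
    case True
    have "(q has_field_derivative deriv q 0) (at 0)"
      using hol by (auto intro: holomorphic_derivI)
    then have "(\<phi> has_field_derivative q 0 / 2) (at 0)"
      unfolding \<phi>_def by (auto intro!: derivative_eq_intros)
    then have "deriv \<phi> 0 = q 0 / 2"
      by (rule DERIV_imp_deriv)
    then have "cmod (q 0 / 2) \<le> 1"
      using Schwarz_Lemma(2)[OF hol\<phi> \<phi>0 \<phi>1 z1] by metis
    then show ?thesis
      using True by (simp add: norm_divide)
  next
    case False
    have le: "cmod (\<phi> z) \<le> cmod z"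
      using Schwarz_Lemma(1)[OF hol\<phi> \<phi>0 \<phi>1 z1] .
    have inv: "z * q z * (1 - \<phi> z) = 2 * \<phi> z"
      using nz[OF z] by (simp add: \<phi>_def field_simps)
    have "1 - cmod z \<le> cmod (1 - \<phi> z)"
      using le norm_triangle_ineq2[of 1 "\<phi> z"] by simp
    then have "cmod z * cmod (q z) * (1 - cmod z) \<le> cmod z * cmod (q z) * cmod (1 - \<phi> z)"
      by (intro mult_left_mono) auto
    also have "\<dots> = 2 * cmod (\<phi> z)"
      using arg_cong[OF inv, of cmod] by (simp add: norm_mult)
    also have "\<dots> \<le> cmod z * 2"
      using le by simp
    finally have "cmod (q z) * (1 - cmod z) \<le> 2"
      using False by (simp add: mult.assoc)
    then show ?thesis
      using z1 by (simp add: field_simps)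
  qed
qed

section \<open>The dilatation\<close>

lemma unit_disk_moebius_denominator:
  assumes "a \<in> unit_disk" "z \<in> unit_disk"
  shows "1 - cnj a * z \<noteq> 0"
proof -
  have "cmod (cnj a * z) < 1"
    using assms mult_strict_mono'[of "cmod a" 1 "cmod z" 1] by (simp add: norm_mult)
  then show ?thesis
    by auto
qed

lemma disk_automorphism_deriv:
  assumes \<omega>: "\<And>z. z \<in> unit_disk \<Longrightarrow> \<omega> z = exp (\<i> * of_real \<theta>) * ((z - a) / (1 - cnj a * z))"
    and a: "a \<in> unit_disk" and z: "z \<in> unit_disk"
  shows "deriv \<omega> z = exp (\<i> * of_real \<theta>) * (of_real (1 - (cmod a)\<^sup>2) / (1 - cnj a * z)\<^sup>2)"
proof -
  note nz = unit_disk_moebius_denominator[OF a z]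
  have "((\<lambda>z. exp (\<i> * of_real \<theta>) * ((z - a) / (1 - cnj a * z))) has_field_derivative
          exp (\<i> * of_real \<theta>) * (of_real (1 - (cmod a)\<^sup>2) / (1 - cnj a * z)\<^sup>2)) (at z)"
    by (rule derivative_eq_intros refl nz)+
       (simp only: of_real_diff complex_norm_square, simp add: algebra_simps power2_eq_square)
  then have "(\<omega> has_field_derivative
          exp (\<i> * of_real \<theta>) * (of_real (1 - (cmod a)\<^sup>2) / (1 - cnj a * z)\<^sup>2)) (at z)"
    by (rule has_field_derivative_transform_within_open[where S = unit_disk]) (use z \<omega> in auto)
  then show ?thesis
    by (rule DERIV_imp_deriv)
qed

text \<open>
  This is the equality case of the Schwarz--Pick inequality. It follows from the identity
  \<open>\<bar>1 - cnj a z\<bar>\<^sup>2 - \<bar>z - a\<bar>\<^sup>2 = (1 - \<bar>a\<bar>\<^sup>2) (1 - \<bar>z\<bar>\<^sup>2)\<close>, whose positivity also gives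
  \<open>\<bar>\<omega>\<bar> < 1\<close>.
\<close>

lemma disk_automorphism_isometry:
  assumes "disk_automorphism \<omega>" and z: "z \<in> unit_disk"
  shows "(1 - (cmod z)\<^sup>2) * cmod (deriv \<omega> z) = 1 - (cmod (\<omega> z))\<^sup>2"
    and "cmod (\<omega> z) < 1"
proof -
  obtain \<theta> a where a: "a \<in> unit_disk"
    and \<omega>: "\<And>z. z \<in> unit_disk \<Longrightarrow> \<omega> z = exp (\<i> * of_real \<theta>) * ((z - a) / (1 - cnj a * z))"
    using assms(1) unfolding disk_automorphism_def by blast
  have nz: "cmod (1 - cnj a * z) > 0"
    using unit_disk_moebius_denominator[OF a z] by simp
  have pos: "1 - (cmod a)\<^sup>2 > 0" "1 - (cmod z)\<^sup>2 > 0"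
    using a z by (auto simp: power_less_one_iff abs_square_less_1)
  have id: "(cmod (1 - cnj a * z))\<^sup>2 - (cmod (z - a))\<^sup>2 = (1 - (cmod a)\<^sup>2) * (1 - (cmod z)\<^sup>2)"
    unfolding cmod_power2 by (simp add: power2_eq_square algebra_simps)
  have W: "cmod (\<omega> z) = cmod (z - a) / cmod (1 - cnj a * z)"
    using \<omega>[OF z] by (simp add: norm_mult norm_divide)
  have "deriv \<omega> z = exp (\<i> * of_real \<theta>) * (of_real (1 - (cmod a)\<^sup>2) / (1 - cnj a * z)\<^sup>2)"
    by (rule disk_automorphism_deriv[OF \<omega> a z])
  then have "cmod (deriv \<omega> z) = \<bar>1 - (cmod a)\<^sup>2\<bar> / (cmod (1 - cnj a * z))\<^sup>2"
    by (simp only: norm_mult norm_divide norm_power norm_of_real norm_exp_i_times mult_1)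
  then have D: "cmod (deriv \<omega> z) = (1 - (cmod a)\<^sup>2) / (cmod (1 - cnj a * z))\<^sup>2"
    using pos by simp
  have W2: "1 - (cmod (\<omega> z))\<^sup>2 = (1 - (cmod a)\<^sup>2) * (1 - (cmod z)\<^sup>2) / (cmod (1 - cnj a * z))\<^sup>2"
    unfolding W id[symmetric] using nz by (simp add: power_divide diff_divide_distrib)
  show "(1 - (cmod z)\<^sup>2) * cmod (deriv \<omega> z) = 1 - (cmod (\<omega> z))\<^sup>2"
    unfolding W2 D by simp
  have "(1 - (cmod a)\<^sup>2) * (1 - (cmod z)\<^sup>2) / (cmod (1 - cnj a * z))\<^sup>2 > 0"
    using pos nz by simp
  then have "(cmod (\<omega> z))\<^sup>2 < 1"
    using W2 by linarith
  then show "cmod (\<omega> z) < 1"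
    by (simp add: abs_square_less_1)
qed

lemma class_F0_jacobian_pos:
  assumes F: "class_F0 f h g" and z: "z \<in> unit_disk"
  shows "jacobian h g z > 0"
proof -
  have h0: "deriv h z \<noteq> 0" and aut: "disk_automorphism (dilatation h g)"
    using F z by (auto simp: class_F0_def)
  have "cmod (deriv g z) < cmod (deriv h z)"
    using disk_automorphism_isometry(2)[OF aut z] h0
    by (simp add: dilatation_def norm_divide)
  then show ?thesis
    unfolding jacobian_def by (simp add: power_strict_mono)
qed

lemma class_F0_pre_schwarzian:
  assumes F: "class_F0 f h g" and z: "z \<in> unit_disk"
  shows "pre_schwarzian h g z =
           deriv (deriv h) z / deriv h z
             - cnj (dilatation h g z) * deriv (dilatation h g) z
                 / of_real (1 - (cmod (dilatation h g z))\<^sup>2)"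
  using F z by (intro pre_schwarzian_eq class_F0_jacobian_pos)
    (auto simp: class_F0_def class_H_def)

section \<open>The upper bound\<close>

lemma class_F0_pre_schwarzian_bound:
  assumes F: "class_F0 f h g" and z: "z \<in> unit_disk"
  shows "(1 - (cmod z)\<^sup>2) * cmod (pre_schwarzian h g z) \<le> 5"
proof -
  define \<omega> where "\<omega> = dilatation h g"
  define q where "q = (\<lambda>w. deriv (deriv h) w / deriv h w)"
  define s where "s = 1 - (cmod z)\<^sup>2"
  have aut: "disk_automorphism \<omega>" and hol: "h holomorphic_on unit_disk"
    and nz: "\<And>w. w \<in> unit_disk \<Longrightarrow> deriv h w \<noteq> 0"
    and re: "\<And>w. w \<in> unit_disk \<Longrightarrow> Re (1 + w * q w) > 0"
    using F by (auto simp: class_F0_def class_H_def \<omega>_def q_def)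
  have z1: "cmod z < 1"
    using z by simp
  then have s: "s > 0" "s = (1 + cmod z) * (1 - cmod z)"
    by (simp_all add: s_def abs_square_less_1) (simp add: power2_eq_square algebra_simps)
  have "q holomorphic_on unit_disk"
    unfolding q_def using nz by (intro holomorphic_intros holomorphic_deriv hol) auto
  then have "cmod (q z) \<le> 2 / (1 - cmod z)"
    using convex_pre_schwarzian_bound re z by blast
  then have "s * cmod (q z) \<le> s * (2 / (1 - cmod z))"
    using s by (intro mult_left_mono) auto
  also have "\<dots> = 2 * (1 + cmod z)"
    using z1 by (simp add: s(2))
  also have "\<dots> \<le> 4"
    using z1 by simp
  finally have A: "s * cmod (q z) \<le> 4" .
  have lt: "cmod (\<omega> z) < 1"
    using disk_automorphism_isometry(2)[OF aut z] .
  then have W: "1 - (cmod (\<omega> z))\<^sup>2 > 0"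
    by (simp add: abs_square_less_1)
  have "s * cmod (cnj (\<omega> z) * deriv \<omega> z / of_real (1 - (cmod (\<omega> z))\<^sup>2))
          = cmod (\<omega> z) * ((s * cmod (deriv \<omega> z)) / (1 - (cmod (\<omega> z))\<^sup>2))"
    unfolding norm_divide norm_mult norm_of_real using W by simp
  also have "\<dots> = cmod (\<omega> z)"
    using W disk_automorphism_isometry(1)[OF aut z] by (simp add: s_def)
  finally have B: "s * cmod (cnj (\<omega> z) * deriv \<omega> z / of_real (1 - (cmod (\<omega> z))\<^sup>2)) \<le> 1"
    using lt by simp
  have "cmod (pre_schwarzian h g z) \<le>
          cmod (q z) + cmod (cnj (\<omega> z) * deriv \<omega> z / of_real (1 - (cmod (\<omega> z))\<^sup>2))"
    unfolding class_F0_pre_schwarzian[OF F z] q_def \<omega>_def by (rule norm_triangle_ineq4)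
  then have "s * cmod (pre_schwarzian h g z) \<le>
          s * (cmod (q z) + cmod (cnj (\<omega> z) * deriv \<omega> z / of_real (1 - (cmod (\<omega> z))\<^sup>2)))"
    using s by (intro mult_left_mono) auto
  with A B show ?thesis
    by (simp add: s_def distrib_left)
qed

section \<open>Sharpness\<close>

lemma half_plane_map_derivs:
  assumes "z \<in> unit_disk"
  shows "deriv (\<lambda>z. z / (1 - z)) z = 1 / (1 - z)\<^sup>2"
    and "deriv (deriv (\<lambda>z. z / (1 - z))) z = 2 / (1 - z) ^ 3"
proof -
  have nz: "1 - w \<noteq> 0" if "w \<in> unit_disk" for w :: complex
    using that by auto
  have 1: "deriv (\<lambda>z. z / (1 - z)) w = 1 / (1 - w)\<^sup>2" if "w \<in> unit_disk" for w :: complex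
    by (rule DERIV_imp_deriv)
       (use nz[OF that] in \<open>auto intro!: derivative_eq_intros simp: power2_eq_square field_simps\<close>)
  then show "deriv (\<lambda>z. z / (1 - z)) z = 1 / (1 - z)\<^sup>2"
    using assms .
  have "((\<lambda>w. 1 / (1 - w)\<^sup>2) has_field_derivative 2 / (1 - z) ^ 3) (at z)"
    using nz[OF assms]
    by (auto intro!: derivative_eq_intros simp: power2_eq_square power3_eq_cube divide_simps)
  then have "(deriv (\<lambda>z. z / (1 - z)) has_field_derivative 2 / (1 - z) ^ 3) (at z)"
    by (rule has_field_derivative_transform_within_open[where S = unit_disk]) (use assms 1 in auto)
  then show "deriv (deriv (\<lambda>z. z / (1 - z))) z = 2 / (1 - z) ^ 3"
    by (rule DERIV_imp_deriv)
qed

text \<open>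
  The disk is convex, so \<open>\<omega> h'\<close> has a primitive there: the analytic part and the dilatation of a
  member of \<open>\<F>\<^sub>0\<close> can be prescribed independently, and no explicit co-analytic part is needed.
\<close>

lemma half_plane_map_with_dilatation:
  fixes a :: real
  assumes a: "\<bar>a\<bar> < 1"
  defines "h \<equiv> (\<lambda>z. z / (1 - z))"
  obtains f g where "class_F0 f h g"
    and "\<And>z. z \<in> unit_disk \<Longrightarrow> dilatation h g z = (z - of_real a) / (1 - of_real a * z)"
proof -
  have nz: "1 - z \<noteq> 0" if "z \<in> unit_disk" for z :: complex
    using that by auto
  have ad: "of_real a \<in> unit_disk"
    using a by simp
  have nza: "1 - of_real a * z \<noteq> 0" if "z \<in> unit_disk" for z :: complex
    using unit_disk_moebius_denominator[OF ad that] by simp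
  have d1: "deriv h z = 1 / (1 - z)\<^sup>2" and d2: "deriv (deriv h) z = 2 / (1 - z) ^ 3"
    if "z \<in> unit_disk" for z
    using half_plane_map_derivs[OF that] by (simp_all add: h_def)
  define k :: "complex \<Rightarrow> complex"
    where "k = (\<lambda>z. (z - of_real a) / (1 - of_real a * z) * (1 / (1 - z)\<^sup>2))"
  have "k holomorphic_on unit_disk"
    unfolding k_def using nz nza by (intro holomorphic_intros) auto
  then obtain g0 where g0: "\<And>z. z \<in> unit_disk \<Longrightarrow> (g0 has_field_derivative k z) (at z within unit_disk)"
    using holomorphic_convex_primitive'[of unit_disk k] by auto
  define g where "g = (\<lambda>z. g0 z - g0 0)"
  have gd: "(g has_field_derivative k z) (at z)" if "z \<in> unit_disk" for z
    using g0[OF that] that unfolding g_def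
    by (auto intro!: derivative_eq_intros simp: at_within_open[OF that])
  have dil: "dilatation h g z = (z - of_real a) / (1 - of_real a * z)" if "z \<in> unit_disk" for z
    using nz[OF that] DERIV_imp_deriv[OF gd[OF that]]
    by (simp add: dilatation_def d1[OF that] k_def)
  have "Re (1 + z * deriv (deriv h) z / deriv h z) > 0" if z: "z \<in> unit_disk" for z
  proof -
    have "1 + z * deriv (deriv h) z / deriv h z = (1 + z) / (1 - z)"
      unfolding d1[OF z] d2[OF z] using nz[OF z]
      by (simp add: divide_simps) (simp add: power2_eq_square power3_eq_cube algebra_simps)
    also have "Re \<dots> = (1 - (cmod z)\<^sup>2) / (cmod (1 - z))\<^sup>2"
      unfolding Re_divide cmod_power2 by (simp add: power2_eq_square algebra_simps)
    also have "\<dots> > 0"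
      using z nz[OF z] by (simp add: abs_square_less_1)
    finally show ?thesis .
  qed
  moreover have "disk_automorphism (dilatation h g)"
    unfolding disk_automorphism_def
    by (rule exI[of _ 0], rule bexI[OF _ ad]) (simp add: dil)
  moreover have "class_H (\<lambda>z. h z + cnj (g z)) h g"
  proof -
    have "h holomorphic_on unit_disk"
      unfolding h_def using nz by (intro holomorphic_intros) auto
    moreover have "g holomorphic_on unit_disk"
      using gd holomorphic_on_open by blast
    moreover have "deriv h 0 = 1"
      using d1[of 0] by simp
    ultimately show ?thesis
      by (auto simp: class_H_def h_def g_def)
  qed
  ultimately have "class_F0 (\<lambda>z. h z + cnj (g z)) h g"
    using d1 nz by (auto simp: class_F0_def)
  then show thesis
    using dil by (rule that)
qed

lemma class_F0_norm_near_5: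
  fixes r :: real
  assumes r: "0 < r" "r < 1"
  obtains f h g where "class_F0 f h g" and "pre_schwarzian_norm h g \<ge> ereal (2 + 3 * r)"
proof -
  \<comment> \<open>The automorphism with zero \<open>a\<close> sends \<open>0\<close> to \<open>-a\<close> and \<open>a\<close> to \<open>0\<close>. The point \<open>r\<close> is the
    hyperbolic midpoint of \<open>0\<close> and \<open>a\<close>, hence goes to that of \<open>-a\<close> and \<open>0\<close>, which is \<open>-r\<close>.\<close>
  define a where "a = 2 * r / (1 + r\<^sup>2)"
  define h :: "complex \<Rightarrow> complex" where "h = (\<lambda>z. z / (1 - z))"
  have r2: "1 + r\<^sup>2 > 0" "r\<^sup>2 < 1"
    using r by (auto simp: abs_square_less_1 add_pos_nonneg)
  have "(1 - r)\<^sup>2 > 0"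
    using r by simp
  then have "2 * r < 1 + r\<^sup>2"
    by (simp add: power2_eq_square algebra_simps)
  then have a: "\<bar>a\<bar> < 1"
    using r r2 by (simp add: a_def)
  obtain f g where F: "class_F0 f h g"
    and dil: "\<And>z. z \<in> unit_disk \<Longrightarrow> dilatation h g z = (z - of_real a) / (1 - of_real a * z)"
    using half_plane_map_with_dilatation[OF a] unfolding h_def by blast
  have rd: "of_real r \<in> unit_disk" and ad: "of_real a \<in> unit_disk"
    using r a by simp_all
  have e1: "1 - a * r = (1 - r\<^sup>2) / (1 + r\<^sup>2)" and e2: "r - a = - r * (1 - r\<^sup>2) / (1 + r\<^sup>2)"
    and e3: "1 - a\<^sup>2 = ((1 - r\<^sup>2) / (1 + r\<^sup>2))\<^sup>2"
    using r2 unfolding a_def by (simp_all add: divide_simps)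
      (simp_all add: power2_eq_square algebra_simps)
  have "(r - a) / (1 - a * r) = - r"
    using r2 unfolding e1 e2 by simp
  then have w: "dilatation h g (of_real r) = of_real (- r)"
    unfolding dil[OF rd] by (metis of_real_1 of_real_diff of_real_divide of_real_mult)
  have "dilatation h g z = exp (\<i> * of_real 0) * ((z - of_real a) / (1 - cnj (of_real a) * z))"
    if "z \<in> unit_disk" for z
    using dil[OF that] by simp
  note disk_automorphism_deriv[OF this ad rd]
  then have "deriv (dilatation h g) (of_real r) = of_real ((1 - a\<^sup>2) / (1 - a * r)\<^sup>2)"
    by simp
  moreover have "(1 - a\<^sup>2) / (1 - a * r)\<^sup>2 = 1"
    using r2 unfolding e1 e3 by simp
  ultimately have w': "deriv (dilatation h g) (of_real r) = 1"
    by simp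
  have "deriv (deriv h) (of_real r) / deriv h (of_real r) = of_real (2 / (1 - r))"
  proof -
    have "1 - complex_of_real r \<noteq> 0"
      using r by auto
    then show ?thesis
      unfolding h_def half_plane_map_derivs[OF rd]
      by (simp add: power2_eq_square power3_eq_cube)
  qed
  then have "pre_schwarzian h g (of_real r) = of_real (2 / (1 - r) + r / (1 - r\<^sup>2))"
    unfolding class_F0_pre_schwarzian[OF F rd] w w' using r by simp
  then have "cmod (pre_schwarzian h g (of_real r)) = 2 / (1 - r) + r / (1 - r\<^sup>2)"
    using r r2 by (simp only: norm_of_real) simp
  then have "(1 - (cmod (of_real r))\<^sup>2) * cmod (pre_schwarzian h g (of_real r))
      = (1 - r\<^sup>2) * (2 / (1 - r)) + (1 - r\<^sup>2) * (r / (1 - r\<^sup>2))"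
    by (simp only: distrib_left norm_of_real power2_abs)
  also have "(1 - r\<^sup>2) * (r / (1 - r\<^sup>2)) = r"
    using r2 by simp
  also have "(1 - r\<^sup>2) * (2 / (1 - r)) = 2 * (1 + r)"
    using r by (simp add: field_simps power2_eq_square)
  finally have "ereal (2 + 3 * r) =
      ereal ((1 - (cmod (of_real r))\<^sup>2) * cmod (pre_schwarzian h g (of_real r)))"
    by simp
  also have "\<dots> \<le> pre_schwarzian_norm h g"
    unfolding pre_schwarzian_norm_def by (rule SUP_upper[OF rd])
  finally show thesis
    using that[OF F] by blast
qed

theorem theorem4p1:
  shows "(\<forall>f h g. class_F0 f h g \<longrightarrow> pre_schwarzian_norm h g \<le> 5) \<and>
         (\<forall>C::real. (\<forall>f h g. class_F0 f h g \<longrightarrow> pre_schwarzian_norm h g \<le> ereal C) \<longrightarrow> 5 \<le> C)"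
proof (intro conjI allI impI)
  fix f h g
  assume F: "class_F0 f h g"
  have "pre_schwarzian_norm h g \<le> ereal 5"
    unfolding pre_schwarzian_norm_def
    using class_F0_pre_schwarzian_bound[OF F] by (intro SUP_least) simp
  then show "pre_schwarzian_norm h g \<le> 5"
    by simp
next
  fix C :: real
  assume C: "\<forall>f h g. class_F0 f h g \<longrightarrow> pre_schwarzian_norm h g \<le> ereal C"
  have *: "2 + 3 * r \<le> C" if "0 < r" "r < 1" for r
    using class_F0_norm_near_5[OF that] C by (metis ereal_less_eq(3) order_trans)
  show "5 \<le> C"
  proof (rule dense_le_bounded[of 2])
    fix x :: real
    assume "2 < x" "x < 5"
    then show "x \<le> C"
      using *[of "(x - 2) / 3"] by (simp add: field_simps)
  qed simp
qed

end
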